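(* Let $c>0$, $\alpha\ge 0$, and let $\mu_0$ be a probability measure on $[0,1]$. Then there is a unique Nash Equilibrium in the Mean Field Game with Multiple Major Players, i.e. there is exactly one tuple $(u^{c*},u_1^*,u_2^*,\bar\mu)$ satisfying the definition in the context (functions $u^{c*}$ that agree $\mu_0$-almost everywhere being identified).
   Context: Costs. For $u_1,u_2\in\mathbb{R}_+=[0,\infty)$ and $\bar\mu\in[0,1]$, the major players' costs are $$J^1(u_1;u_2,\bar\mu)=-\big(u_1(1-\bar\mu)-u_2\bar\mu\big)-\frac{u_1+1}{u_2+1}+\frac c2u_1^2,$$ $$J^2(u_2;u_1,\bar\mu)=-\big(u_2\bar\mu-u_1(1-\bar\mu)\big)-\frac{u_2+1}{u_1+1}+\frac c2u_2^2.$$ The representative minor player uses a (measurable) feedback function $u^c:[0,1]\to[0,1]$ of its random initial preference $u_0^c\sim\mu_0$, and has cost $$J^c(u^c;\bar\mu,u_1,u_2)=\mathbb{E}_{u_0^c\sim\mu_0}\Big\{\tfrac12(u^c(u_0^c)-u_0^c)^2+\tfrac12(u^c(u_0^c)-\bar\mu)^2-\Big[(\alpha+u_1)u^c(u_0^c)+(\alpha+u_2)(1-u^c(u_0^c))-\tfrac{u^c(u_0^c)^2+(1-u^c(u_0^c))^2}{2}\Big]\Big\}.$$ Definition. A tuple $(u^{c*},u_1^*,u_2^*,\bar\mu)$, with $u^{c*}:[0,1]\to[0,1]$ measurable, $u_1^*,u_2^*\in\mathbb{R}_+$ and $\bar\mu=\mathbb{E}_{u_0^c\sim\mu_0}[u^{c*}(u_0^c)]$,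 is a Nash Equilibrium in the Mean Field Game with Multiple Major Players if for every measurable $u^c:[0,1]\to[0,1]$ and all $u_1,u_2\in\mathbb{R}_+$: $$J^c(u^c;\bar\mu,u_1^*,u_2^* )\ge J^c(u^{c*};\bar\mu,u_1^*,u_2^* ),$$ $$J^1(u_1;u_2^*,\bar\mu)\ge J^1(u_1^*;u_2^*,\bar\mu),$$ $$J^2(u_2;u_1^*,\bar\mu)\ge J^2(u_2^*;u_1^*,\bar\mu).$$ (The mean field $\bar\mu$ is the mean of the fixed function $u^{c*}$ and so does not change when a major player deviates.) *)

theory Defs
  imports "HOL-Probability.Probability"
begin

definition unit_borel :: "real measure" where
  "unit_borel = restrict_space borel {0..1}"

text \<open>Measurable feedback functions from [0,1] to [0,1]. Only the values on [0,1] matter; values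
  of the total function outside [0,1] are unconstrained.\<close>

definition feedbacks :: "(real \<Rightarrow> real) set" where
  "feedbacks = unit_borel \<rightarrow>\<^sub>M unit_borel"

definition J1 :: "real \<Rightarrow> real \<Rightarrow> real \<Rightarrow> real \<Rightarrow> real" where
  "J1 c u1 u2 m = - (u1 * (1 - m) - u2 * m) - (u1 + 1) / (u2 + 1) + c / 2 * u1\<^sup>2"

definition J2 :: "real \<Rightarrow> real \<Rightarrow> real \<Rightarrow> real \<Rightarrow> real" where
  "J2 c u2 u1 m = - (u2 * m - u1 * (1 - m)) - (u2 + 1) / (u1 + 1) + c / 2 * u2\<^sup>2"

definition Jc :: "real \<Rightarrow> real measure \<Rightarrow> (real \<Rightarrow> real) \<Rightarrow> real \<Rightarrow> real \<Rightarrow> real \<Rightarrow> real" where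
  "Jc \<alpha> \<mu>0 uc m u1 u2 =
    (LINT x|\<mu>0. 1 / 2 * (uc x - x)\<^sup>2 + 1 / 2 * (uc x - m)\<^sup>2
       - ((\<alpha> + u1) * uc x + (\<alpha> + u2) * (1 - uc x) - ((uc x)\<^sup>2 + (1 - uc x)\<^sup>2) / 2))"

definition nash_equilibrium ::
  "real \<Rightarrow> real \<Rightarrow> real measure \<Rightarrow> (real \<Rightarrow> real) \<Rightarrow> real \<Rightarrow> real \<Rightarrow> real \<Rightarrow> bool" where
  "nash_equilibrium c \<alpha> \<mu>0 uc u1 u2 m \<longleftrightarrow>
    uc \<in> feedbacks \<and> 0 \<le> u1 \<and> 0 \<le> u2 \<and> m = (LINT x|\<mu>0. uc x) \<and>
    (\<forall>vc \<in> feedbacks. Jc \<alpha> \<mu>0 vc m u1 u2 \<ge> Jc \<alpha> \<mu>0 uc m u1 u2) \<and>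
    (\<forall>v1 \<ge> 0. J1 c v1 u2 m \<ge> J1 c u1 u2 m) \<and>
    (\<forall>v2 \<ge> 0. J2 c v2 u1 m \<ge> J2 c u2 u1 m)"

end

theory Submission
  imports Defs
begin

text \<open>
  Each player's problem, with the other players' actions held fixed, is the minimisation of a
  strictly convex quadratic, so equilibria are exactly the solutions of three explicit first-order
  equations (lemma \<open>nash_equilibrium_iff\<close>): the minor player projects
  \<open>(x + 1 + m + u1 - u2) / 4\<close> onto the unit interval for almost every \<open>x\<close>, and
  \<open>c * u1 = 1 - m + 1 / (u2 + 1)\<close>, \<open>c * u2 = m + 1 / (u1 + 1)\<close>,
  together with the consistency condition that \<open>m\<close> is the mean of the minor player's response.

  A solution exists by Brouwer's theorem, because the right-hand sides define a continuous self-map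
  of the box \<open>[0, 2/c] \<times> [0, 2/c] \<times> [0, 1]\<close>.

  Uniqueness is a monotonicity argument. At a solution \<open>c * (u1 + 1) * (u2 + 1) > 1\<close>, which makes
  the linear system satisfied by the differences of two solutions nonsingular and forces
  \<open>u1 - u2\<close> to be a nonincreasing function of \<open>m\<close> (lemma \<open>major_difference_antimono\<close>). The mean response
  is nondecreasing and (1/4)-Lipschitz in \<open>1 + m + u1 - u2\<close>, so raising \<open>m\<close> raises the mean
  response by at most a quarter of the increase, and the consistency condition can hold for only
  one \<open>m\<close>.
\<close>

section \<open>Best responses of the major players\<close>

lemma quadratic_minimizer_iff:
  fixes c q u :: real
  assumes "c > 0" and "q \<ge> 0"
  shows "(0 \<le> u \<and> (\<forall>v\<ge>0. c / 2 * v\<^sup>2 - q * v \<ge> c / 2 * u\<^sup>2 - q * u)) \<longleftrightarrow> u = q / c"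
proof -
  have complete_square: "c / 2 * v\<^sup>2 - q * v = c / 2 * (v - q / c)\<^sup>2 - q\<^sup>2 / (2 * c)" for v
    using assms(1) by (simp add: field_simps power2_eq_square)
  show ?thesis
  proof
    assume u: "0 \<le> u \<and> (\<forall>v\<ge>0. c / 2 * v\<^sup>2 - q * v \<ge> c / 2 * u\<^sup>2 - q * u)"
    have "0 \<le> q / c" using assms by simp
    with u have "c / 2 * u\<^sup>2 - q * u \<le> c / 2 * (q / c)\<^sup>2 - q * (q / c)" by blast
    then have "c / 2 * (u - q / c)\<^sup>2 \<le> 0" unfolding complete_square by simp
    then have "(u - q / c)\<^sup>2 \<le> 0" using assms(1) by (simp add: mult_le_0_iff)
    then show "u = q / c" by simp
  next
    assume "u = q / c"
    then show "0 \<le> u \<and> (\<forall>v\<ge>0. c / 2 * v\<^sup>2 - q * v \<ge> c / 2 * u\<^sup>2 - q * u)"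
      unfolding complete_square using assms by simp
  qed
qed

lemma J1_minimizer_iff:
  assumes "c > 0" and "m \<le> 1" and "0 \<le> u2"
  shows "(0 \<le> u1 \<and> (\<forall>v\<ge>0. J1 c v u2 m \<ge> J1 c u1 u2 m)) \<longleftrightarrow> u1 = (1 - m + 1 / (u2 + 1)) / c"
proof -
  have "J1 c v u2 m =
      (c / 2 * v\<^sup>2 - (1 - m + 1 / (u2 + 1)) * v) + (u2 * m - 1 / (u2 + 1))" for v
    by (simp add: J1_def algebra_simps add_divide_distrib)
  then show ?thesis
    using quadratic_minimizer_iff[of c "1 - m + 1 / (u2 + 1)" u1] assms by simp
qed

lemma J2_minimizer_iff:
  assumes "c > 0" and "0 \<le> m" and "0 \<le> u1"
  shows "(0 \<le> u2 \<and> (\<forall>v\<ge>0. J2 c v u1 m \<ge> J2 c u2 u1 m)) \<longleftrightarrow> u2 = (m + 1 / (u1 + 1)) / c"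
proof -
  have "J2 c v u1 m =
      (c / 2 * v\<^sup>2 - (m + 1 / (u1 + 1)) * v) + (u1 * (1 - m) - 1 / (u1 + 1))" for v
    by (simp add: J2_def algebra_simps add_divide_distrib)
  then show ?thesis
    using quadratic_minimizer_iff[of c "m + 1 / (u1 + 1)" u2] assms by simp
qed

section \<open>Best response of the minor player\<close>

text \<open>The parameter \<open>s\<close> stands for \<open>1 + m + u1 - u2\<close>, the only combination of the mean field and the
  major players' actions that influences the minor player's choice.\<close>

definition minor_response :: "real \<Rightarrow> real \<Rightarrow> real" where
  "minor_response s x = max 0 (min 1 ((x + s) / 4))"

definition mean_response :: "real measure \<Rightarrow> real \<Rightarrow> real" where
  "mean_response \<mu>0 s = (LINT x|\<mu>0. minor_response s x)"

definition minor_cost :: "real \<Rightarrow> real \<Rightarrow> real \<Rightarrow> real \<Rightarrow> real \<Rightarrow> real \<Rightarrow> real" where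
  "minor_cost \<alpha> m u1 u2 x v = 1 / 2 * (v - x)\<^sup>2 + 1 / 2 * (v - m)\<^sup>2
       - ((\<alpha> + u1) * v + (\<alpha> + u2) * (1 - v) - (v\<^sup>2 + (1 - v)\<^sup>2) / 2)"

lemma minor_response_range [simp]: "0 \<le> minor_response s x" "minor_response s x \<le> 1"
  by (auto simp: minor_response_def)

lemma minor_response_increment:
  assumes "s \<le> t"
  shows "minor_response s x \<le> minor_response t x"
    and "minor_response t x \<le> minor_response s x + (t - s) / 4"
  using assms by (auto simp: minor_response_def max_def min_def field_simps)

text \<open>The cost is quadratic in \<open>v\<close> with leading coefficient 2, and the first-order term at the
  projected minimiser is nonnegative towards every admissible \<open>v\<close>; what remains is the quadratic
  term. This growth bound gives optimality and almost sure uniqueness at once.\<close>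

lemma minor_cost_gap:
  assumes "0 \<le> v" and "v \<le> 1"
  shows "minor_cost \<alpha> m u1 u2 x v \<ge>
    minor_cost \<alpha> m u1 u2 x (minor_response (1 + m + u1 - u2) x)
      + 2 * (v - minor_response (1 + m + u1 - u2) x)\<^sup>2"
proof -
  define y where "y = (x + (1 + m + u1 - u2)) / 4"
  define w where "w = minor_response (1 + m + u1 - u2) x"
  have w: "w = max 0 (min 1 y)" by (simp add: w_def y_def minor_response_def)
  have "minor_cost \<alpha> m u1 u2 x v - minor_cost \<alpha> m u1 u2 x w - 2 * (v - w)\<^sup>2
      = 4 * ((w - y) * (v - w))"
    by (simp add: minor_cost_def y_def power2_eq_square field_simps)
  moreover have "0 \<le> (w - y) * (v - w)"
    using assms by (auto simp: w max_def min_def mult_nonpos_nonneg mult_nonpos_nonpos)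
  ultimately show ?thesis unfolding w_def by linarith
qed

lemma feedbacks_iff:
  "f \<in> feedbacks \<longleftrightarrow> f \<in> borel_measurable unit_borel \<and> (\<forall>x\<in>{0..1}. 0 \<le> f x \<and> f x \<le> 1)"
  unfolding feedbacks_def unit_borel_def
  by (auto simp: measurable_restrict_space2_iff space_restrict_space Pi_iff)

lemma minor_response_feedback: "minor_response s \<in> feedbacks"
proof -
  have "minor_response s \<in> borel_measurable borel"
    unfolding minor_response_def[abs_def] by measurable
  then show ?thesis
    unfolding feedbacks_iff unit_borel_def by (simp add: measurable_restrict_space1)
qed

locale initial_preference = prob_space \<mu>0 for \<mu>0 :: "real measure" +
  assumes sets_eq: "sets \<mu>0 = sets unit_borel"
begin

lemma space_eq: "space \<mu>0 = {0..1}"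
  using sets_eq_imp_space_eq[OF sets_eq] by (simp add: unit_borel_def space_restrict_space)

lemma feedback_measurable: "f \<in> feedbacks \<Longrightarrow> f \<in> borel_measurable \<mu>0"
  using measurable_cong_sets[OF sets_eq refl, of borel] unfolding feedbacks_iff by blast

lemma feedback_range: "f \<in> feedbacks \<Longrightarrow> x \<in> space \<mu>0 \<Longrightarrow> 0 \<le> f x \<and> f x \<le> 1"
  by (simp add: feedbacks_iff space_eq)

lemma integrable_feedback: "f \<in> feedbacks \<Longrightarrow> integrable \<mu>0 f"
  by (rule integrable_const_bound[where B = 1])
    (auto intro!: AE_I2 dest: feedback_range feedback_measurable)

lemma mean_feedback_range:
  assumes "f \<in> feedbacks"
  shows "0 \<le> (LINT x|\<mu>0. f x)" and "(LINT x|\<mu>0. f x) \<le> 1"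
proof -
  show "0 \<le> (LINT x|\<mu>0. f x)"
    using feedback_range[OF assms] by (intro integral_nonneg_AE) auto
  have "(LINT x|\<mu>0. f x) \<le> (LINT x|\<mu>0. 1)"
    using feedback_range[OF assms]
    by (intro integral_mono integrable_feedback[OF assms]) auto
  then show "(LINT x|\<mu>0. f x) \<le> 1" by (simp add: prob_space)
qed

lemma integrable_square_difference:
  assumes "f \<in> feedbacks" and "g \<in> feedbacks"
  shows "integrable \<mu>0 (\<lambda>x. (f x - g x)\<^sup>2)"
proof (rule integrable_const_bound[where B = 1])
  have "\<bar>f x - g x\<bar> \<le> 1" if "x \<in> space \<mu>0" for x
    using feedback_range[OF assms(1) that] feedback_range[OF assms(2) that] by linarith
  then show "AE x in \<mu>0. norm ((f x - g x)\<^sup>2) \<le> 1"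
    by (auto simp: abs_square_le_1)
  show "(\<lambda>x. (f x - g x)\<^sup>2) \<in> borel_measurable \<mu>0"
    using assms[THEN feedback_measurable] by measurable
qed

lemma Jc_eq: "Jc \<alpha> \<mu>0 f m u1 u2 = (LINT x|\<mu>0. minor_cost \<alpha> m u1 u2 x (f x))"
  by (simp add: Jc_def minor_cost_def)

lemma integrable_minor_cost:
  assumes f: "f \<in> feedbacks"
  shows "integrable \<mu>0 (\<lambda>x. minor_cost \<alpha> m u1 u2 x (f x))"
proof -
  have "(\<lambda>x. x) \<in> feedbacks" and "(\<lambda>x. 0) \<in> feedbacks"
    by (simp_all add: feedbacks_iff unit_borel_def measurable_restrict_space1)
  then have sq: "integrable \<mu>0 (\<lambda>x. (f x - x)\<^sup>2)" "integrable \<mu>0 (\<lambda>x. (f x)\<^sup>2)"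
    using integrable_square_difference[OF f, of "\<lambda>x. x"]
      integrable_square_difference[OF f, of "\<lambda>x. 0"] by simp_all
  have "minor_cost \<alpha> m u1 u2 x v = 1 / 2 * (v - x)\<^sup>2 + 3 / 2 * v\<^sup>2
      + (u2 - u1 - m - 1) * v + (m\<^sup>2 / 2 + 1 / 2 - \<alpha> - u2)" for x v
    by (simp add: minor_cost_def power2_eq_square field_simps)
  then show ?thesis
    using sq integrable_feedback[OF f] by simp
qed

text \<open>Integrating the growth bound shows that the cost of any competitor exceeds the cost of the
  pointwise minimiser by at least twice their squared \<open>L\<^sup>2\<close> distance.\<close>

lemma Jc_minimizer_iff:
  assumes f: "f \<in> feedbacks"
  shows "(\<forall>g\<in>feedbacks. Jc \<alpha> \<mu>0 g m u1 u2 \<ge> Jc \<alpha> \<mu>0 f m u1 u2) \<longleftrightarrow>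
    (AE x in \<mu>0. f x = minor_response (1 + m + u1 - u2) x)"
proof -
  define w where "w = minor_response (1 + m + u1 - u2)"
  have w: "w \<in> feedbacks" by (simp add: w_def minor_response_feedback)
  have gap: "Jc \<alpha> \<mu>0 g m u1 u2 \<ge> Jc \<alpha> \<mu>0 w m u1 u2 + 2 * (LINT x|\<mu>0. (g x - w x)\<^sup>2)"
    if g: "g \<in> feedbacks" for g
  proof -
    have "(LINT x|\<mu>0. minor_cost \<alpha> m u1 u2 x (w x) + 2 * (g x - w x)\<^sup>2)
        \<le> (LINT x|\<mu>0. minor_cost \<alpha> m u1 u2 x (g x))"
      using minor_cost_gap feedback_range[OF g]
      by (intro integral_mono Bochner_Integration.integrable_add integrable_mult_right
          integrable_minor_cost integrable_square_difference g w) (simp add: w_def)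
    then show ?thesis
      by (simp add: Jc_eq integrable_minor_cost integrable_square_difference g w)
  qed
  show ?thesis
  proof
    assume "\<forall>g\<in>feedbacks. Jc \<alpha> \<mu>0 g m u1 u2 \<ge> Jc \<alpha> \<mu>0 f m u1 u2"
    with gap[OF f] w have "(LINT x|\<mu>0. (f x - w x)\<^sup>2) \<le> 0" by fastforce
    moreover have "0 \<le> (LINT x|\<mu>0. (f x - w x)\<^sup>2)" by simp
    ultimately have "(LINT x|\<mu>0. (f x - w x)\<^sup>2) = 0" by linarith
    then have "AE x in \<mu>0. (f x - w x)\<^sup>2 = 0"
      using integral_nonneg_eq_0_iff_AE[OF integrable_square_difference[OF f w]] by simp
    then show "AE x in \<mu>0. f x = minor_response (1 + m + u1 - u2) x"
      by (simp add: w_def)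
  next
    assume ae: "AE x in \<mu>0. f x = minor_response (1 + m + u1 - u2) x"
    have "Jc \<alpha> \<mu>0 f m u1 u2 = Jc \<alpha> \<mu>0 w m u1 u2"
      unfolding Jc_eq using ae integrable_minor_cost[OF f] integrable_minor_cost[OF w]
      by (intro integral_cong_AE borel_measurable_integrable) (auto simp: w_def)
    moreover have "Jc \<alpha> \<mu>0 w m u1 u2 \<le> Jc \<alpha> \<mu>0 g m u1 u2" if "g \<in> feedbacks" for g
    proof -
      have "0 \<le> (LINT x|\<mu>0. (g x - w x)\<^sup>2)" by simp
      with gap[OF that] show ?thesis by linarith
    qed
    ultimately show "\<forall>g\<in>feedbacks. Jc \<alpha> \<mu>0 g m u1 u2 \<ge> Jc \<alpha> \<mu>0 f m u1 u2" by simp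
  qed
qed

section \<open>Equilibria as solutions of the first-order system\<close>

lemma mean_response_increment:
  assumes "s \<le> t"
  shows "mean_response \<mu>0 s \<le> mean_response \<mu>0 t"
    and "mean_response \<mu>0 t \<le> mean_response \<mu>0 s + (t - s) / 4"
proof -
  note int = integrable_feedback[OF minor_response_feedback]
  show "mean_response \<mu>0 s \<le> mean_response \<mu>0 t"
    unfolding mean_response_def
    by (intro integral_mono int minor_response_increment assms)
  have "mean_response \<mu>0 t \<le> (LINT x|\<mu>0. minor_response s x + (t - s) / 4)"
    unfolding mean_response_def
    by (intro integral_mono int minor_response_increment assms
        Bochner_Integration.integrable_add) simp
  also have "\<dots> = mean_response \<mu>0 s + (t - s) / 4"
    by (simp add: mean_response_def int prob_space)
  finally show "mean_response \<mu>0 t \<le> mean_response \<mu>0 s + (t - s) / 4" .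
qed

lemma mean_response_continuous: "continuous_on UNIV (mean_response \<mu>0)"
proof -
  have lip: "\<bar>mean_response \<mu>0 s - mean_response \<mu>0 t\<bar> \<le> 1 / 4 * \<bar>s - t\<bar>" for s t
    using mean_response_increment[of s t] mean_response_increment[of t s]
    by (cases "s \<le> t") (simp_all add: field_simps)
  have "(1 / 4)-lipschitz_on UNIV (mean_response \<mu>0)"
    by (rule lipschitz_onI) (use lip in \<open>auto simp: dist_real_def\<close>)
  then show ?thesis by (rule lipschitz_on_continuous_on)
qed

lemma mean_response_range: "0 \<le> mean_response \<mu>0 s" "mean_response \<mu>0 s \<le> 1"
  using mean_feedback_range[OF minor_response_feedback] by (simp_all add: mean_response_def)

text \<open>The consistency condition confines \<open>m\<close> to the unit interval. The unconstrained minimisers of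
  both major players' costs are then nonnegative, so the constraints on \<open>u1\<close> and \<open>u2\<close> never bind
  and the first-order conditions are equations rather than variational inequalities.\<close>

lemma nash_equilibrium_iff:
  assumes c: "c > 0"
  shows "nash_equilibrium c \<alpha> \<mu>0 f u1 u2 m \<longleftrightarrow>
    f \<in> feedbacks \<and> 0 \<le> u1 \<and> 0 \<le> u2 \<and>
    (AE x in \<mu>0. f x = minor_response (1 + m + u1 - u2) x) \<and>
    m = mean_response \<mu>0 (1 + m + u1 - u2) \<and>
    u1 = (1 - m + 1 / (u2 + 1)) / c \<and> u2 = (m + 1 / (u1 + 1)) / c"
proof (cases "f \<in> feedbacks \<and> 0 \<le> u1 \<and> 0 \<le> u2 \<and>
    (AE x in \<mu>0. f x = minor_response (1 + m + u1 - u2) x)")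
  case False
  then show ?thesis unfolding nash_equilibrium_def using Jc_minimizer_iff by blast
next
  case True
  then have f: "f \<in> feedbacks" and u: "0 \<le> u1" "0 \<le> u2"
    and ae: "AE x in \<mu>0. f x = minor_response (1 + m + u1 - u2) x" by auto
  have mean: "(LINT x|\<mu>0. f x) = mean_response \<mu>0 (1 + m + u1 - u2)"
    unfolding mean_response_def using ae f minor_response_feedback
    by (intro integral_cong_AE feedback_measurable) auto
  show ?thesis
  proof (cases "m = mean_response \<mu>0 (1 + m + u1 - u2)")
    case False
    with mean show ?thesis by (auto simp: nash_equilibrium_def)
  next
    case consistent: True
    then have "0 \<le> m" "m \<le> 1" using mean_response_range by metis+
    then have "(\<forall>v\<ge>0. J1 c v u2 m \<ge> J1 c u1 u2 m) \<longleftrightarrow> u1 = (1 - m + 1 / (u2 + 1)) / c"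
      and "(\<forall>v\<ge>0. J2 c v u1 m \<ge> J2 c u2 u1 m) \<longleftrightarrow> u2 = (m + 1 / (u1 + 1)) / c"
      using J1_minimizer_iff[OF c, of m u2 u1] J2_minimizer_iff[OF c, of m u1 u2] u by simp_all
    then show ?thesis
      unfolding nash_equilibrium_def using Jc_minimizer_iff[OF f, of \<alpha> m u1 u2] True consistent mean
      by metis
  qed
qed

section \<open>Existence\<close>

lemma first_order_solution_exists:
  assumes c: "c > 0"
  shows "\<exists>u1 u2 m. 0 \<le> u1 \<and> 0 \<le> u2 \<and> m = mean_response \<mu>0 (1 + m + u1 - u2) \<and>
    u1 = (1 - m + 1 / (u2 + 1)) / c \<and> u2 = (m + 1 / (u1 + 1)) / c"
proof -
  define S :: "(real \<times> real \<times> real) set" where "S = {0..2 / c} \<times> {0..2 / c} \<times> {0..1}"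
  define F :: "real \<times> real \<times> real \<Rightarrow> real \<times> real \<times> real" where
    "F = (\<lambda>p. ((1 - snd (snd p) + 1 / (fst (snd p) + 1)) / c,
      (snd (snd p) + 1 / (fst p + 1)) / c,
      mean_response \<mu>0 (1 + snd (snd p) + fst p - fst (snd p))))"
  have "compact S" "convex S" unfolding S_def by (intro compact_Times convex_Times; simp)+
  moreover have "S \<noteq> {}" using c by (simp add: S_def)
  moreover have "continuous_on S F"
    unfolding F_def using c
    by (intro continuous_intros continuous_on_compose2[OF mean_response_continuous])
      (auto simp: S_def)
  moreover have "F ` S \<subseteq> S"
  proof (clarsimp simp: S_def F_def mean_response_range)
    fix u1 u2 m :: real
    assume "0 \<le> u1" "0 \<le> u2" "0 \<le> m" "m \<le> 1"
    moreover from this have "0 \<le> 1 / (u1 + 1)" "1 / (u1 + 1) \<le> 1" "0 \<le> 1 / (u2 + 1)" "1 / (u2 + 1) \<le> 1"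
      by simp_all
    ultimately show "0 \<le> (1 - m + 1 / (u2 + 1)) / c \<and> (1 - m + 1 / (u2 + 1)) / c \<le> 2 / c \<and>
      0 \<le> (m + 1 / (u1 + 1)) / c \<and> (m + 1 / (u1 + 1)) / c \<le> 2 / c"
      using c by (intro conjI divide_right_mono divide_nonneg_pos) linarith+
  qed
  ultimately obtain p where p: "p \<in> S" "F p = p" using brouwer[of S F] by blast
  obtain u1 u2 m where "p = (u1, u2, m)" by (cases p)
  moreover from this p(2) have "u1 = (1 - m + 1 / (u2 + 1)) / c \<and> u2 = (m + 1 / (u1 + 1)) / c \<and>
      m = mean_response \<mu>0 (1 + m + u1 - u2)"
    unfolding F_def by (metis fst_conv snd_conv)
  moreover have "0 \<le> u1" "0 \<le> u2" using p(1) calculation(1) by (simp_all add: S_def)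
  ultimately show ?thesis by blast
qed

end

section \<open>Uniqueness\<close>

text \<open>Clearing denominators in the equation for \<open>u1\<close> gives \<open>c * u1 * (u2 + 1) = (1 - m) * (u2 + 1) + 1 \<ge> 1\<close>, and the surplus
  \<open>c * (u2 + 1)\<close> makes the inequality strict.\<close>

lemma major_interaction_bound:
  fixes c m u1 u2 :: real
  assumes "c > 0" and "m \<le> 1" and "0 \<le> u2" and "u1 = (1 - m + 1 / (u2 + 1)) / c"
  shows "c * ((u1 + 1) * (u2 + 1)) > 1"
proof -
  have "c * u1 = 1 - m + 1 / (u2 + 1)" using assms(1,4) by simp
  then have "c * u1 * (u2 + 1) = (1 - m) * (u2 + 1) + 1"
    using assms(3) by (simp add: distrib_right)
  moreover have "0 \<le> (1 - m) * (u2 + 1)" and "0 < c * (u2 + 1)" using assms(1-3) by simp_all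
  moreover have "c * ((u1 + 1) * (u2 + 1)) = c * u1 * (u2 + 1) + c * (u2 + 1)"
    by (simp add: algebra_simps)
  ultimately show ?thesis by linarith
qed

text \<open>The differences \<open>a = u1 - v1\<close> and \<open>b = u2 - v2\<close> of two solutions satisfy
  \<open>c * a + k2 * b = - (m - n)\<close> and \<open>k1 * a + c * b = m - n\<close>, where
  \<open>k1 = 1 / ((u1 + 1) * (v1 + 1))\<close> and \<open>k2 = 1 / ((u2 + 1) * (v2 + 1))\<close>. By the preceding bound,
  applied to both solutions, the determinant \<open>c\<^sup>2 - k1 * k2\<close> is positive, and Cramer's rule yields
  the signs of \<open>a\<close> and \<open>b\<close>.\<close>

lemma major_difference_antimono:
  fixes c m n u1 u2 v1 v2 :: real
  assumes c: "c > 0" and mn: "n \<le> m" "m \<le> 1"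
    and nonneg: "0 \<le> u1" "0 \<le> u2" "0 \<le> v1" "0 \<le> v2"
    and u: "u1 = (1 - m + 1 / (u2 + 1)) / c" "u2 = (m + 1 / (u1 + 1)) / c"
    and v: "v1 = (1 - n + 1 / (v2 + 1)) / c" "v2 = (n + 1 / (v1 + 1)) / c"
  shows "u1 \<le> v1" and "v2 \<le> u2"
proof -
  define k1 where "k1 = 1 / ((u1 + 1) * (v1 + 1))"
  define k2 where "k2 = 1 / ((u2 + 1) * (v2 + 1))"
  have k: "0 < k1" "0 < k2" using nonneg by (simp_all add: k1_def k2_def)
  have resolvent: "1 / ((p + 1) * (q + 1)) * (p - q) = 1 / (q + 1) - 1 / (p + 1)"
    if "0 \<le> p" "0 \<le> q" for p q :: real
    using that by (simp add: divide_simps)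
  have "c * p = q" if "p = q / c" for p q using that c by simp
  note lin = this[OF u(1)] this[OF u(2)] this[OF v(1)] this[OF v(2)]
  have e1: "c * (u1 - v1) + k2 * (u2 - v2) = - (m - n)"
    unfolding right_diff_distrib[of c] using lin(1,3) resolvent[OF nonneg(2,4)]
    by (simp only: k2_def)
  have e2: "k1 * (u1 - v1) + c * (u2 - v2) = m - n"
    unfolding right_diff_distrib[of c] using lin(2,4) resolvent[OF nonneg(1,3)]
    by (simp only: k1_def)
  have det: "0 < c\<^sup>2 - k1 * k2"
  proof -
    have "1 / ((u1 + 1) * (u2 + 1)) < c" "1 / ((v1 + 1) * (v2 + 1)) < c"
      using major_interaction_bound[OF c mn(2) nonneg(2) u(1)]
        major_interaction_bound[OF c _ nonneg(4) v(1)] mn nonneg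
      by (simp_all add: divide_less_eq)
    then have "1 / ((u1 + 1) * (u2 + 1)) * (1 / ((v1 + 1) * (v2 + 1))) < c * c"
      using nonneg by (intro mult_strict_mono) (auto simp: c)
    then show ?thesis by (simp add: k1_def k2_def power2_eq_square mult_ac)
  qed
  have "(c\<^sup>2 - k1 * k2) * (u1 - v1) = - ((c + k2) * (m - n))"
    using e1 e2 by algebra
  moreover have "0 \<le> (c + k2) * (m - n)" using c k mn by simp
  ultimately have "(c\<^sup>2 - k1 * k2) * (u1 - v1) \<le> 0" by linarith
  then show "u1 \<le> v1" using det by (simp add: mult_le_0_iff)
  have "(c\<^sup>2 - k1 * k2) * (u2 - v2) = (c + k1) * (m - n)"
    using e1 e2 by algebra
  moreover have "0 \<le> (c + k1) * (m - n)" using c k mn by simp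
  ultimately have "0 \<le> (c\<^sup>2 - k1 * k2) * (u2 - v2)" by linarith
  then show "v2 \<le> u2" using det by (simp add: zero_le_mult_iff)
qed

context initial_preference
begin

text \<open>If \<open>m > n\<close>, then \<open>u1 - u2 \<le> v1 - v2\<close>, so the arguments of the mean response differ by at most
  \<open>m - n\<close> and its values by at most \<open>(m - n) / 4\<close>, whereas consistency makes the values differ by
  exactly \<open>m - n\<close>.\<close>

lemma consistent_mean_le:
  assumes c: "c > 0" and nonneg: "0 \<le> u1" "0 \<le> u2" "0 \<le> v1" "0 \<le> v2"
    and u: "u1 = (1 - m + 1 / (u2 + 1)) / c" "u2 = (m + 1 / (u1 + 1)) / c"
    and v: "v1 = (1 - n + 1 / (v2 + 1)) / c" "v2 = (n + 1 / (v1 + 1)) / c"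
    and m: "m = mean_response \<mu>0 (1 + m + u1 - u2)"
    and n: "n = mean_response \<mu>0 (1 + n + v1 - v2)"
  shows "m \<le> n"
proof (rule ccontr)
  assume "\<not> m \<le> n"
  then have "n < m" by simp
  have "m \<le> 1" using mean_response_range(2) m by metis
  then have anti: "u1 \<le> v1" "v2 \<le> u2"
    using major_difference_antimono[OF c _ _ nonneg u v] \<open>n < m\<close> by simp_all
  define s where "s = 1 + m + u1 - u2"
  define t where "t = 1 + n + v1 - v2"
  have "s - t \<le> m - n" using anti by (simp add: s_def t_def)
  moreover have "mean_response \<mu>0 s - mean_response \<mu>0 t = m - n"
    unfolding s_def t_def using m n by linarith
  ultimately show False
    using mean_response_increment[of s t] mean_response_increment[of t s] \<open>n < m\<close>
    by (cases "s \<le> t") (simp_all add: field_simps)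
qed

end

theorem theorem4p3:
  fixes c \<alpha> :: real and \<mu>0 :: "real measure"
  assumes "c > 0" and "\<alpha> \<ge> 0"
    and "prob_space \<mu>0" and "sets \<mu>0 = sets unit_borel"
  shows "(\<exists>uc u1 u2 m. nash_equilibrium c \<alpha> \<mu>0 uc u1 u2 m) \<and>
    (\<forall>uc u1 u2 m uc' u1' u2' m'.
       nash_equilibrium c \<alpha> \<mu>0 uc u1 u2 m \<and> nash_equilibrium c \<alpha> \<mu>0 uc' u1' u2' m' \<longrightarrow>
       (AE x in \<mu>0. uc x = uc' x) \<and> u1 = u1' \<and> u2 = u2' \<and> m = m')"
proof (intro conjI[of "\<exists>uc u1 u2 m. nash_equilibrium c \<alpha> \<mu>0 uc u1 u2 m"] allI impI; (elim conjE)?)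
  interpret initial_preference \<mu>0
    using assms(3,4) by (simp add: initial_preference_def initial_preference_axioms_def)
  note iff = nash_equilibrium_iff[OF \<open>c > 0\<close>]
  obtain u1 u2 m where "0 \<le> u1" "0 \<le> u2" "m = mean_response \<mu>0 (1 + m + u1 - u2)"
    "u1 = (1 - m + 1 / (u2 + 1)) / c" "u2 = (m + 1 / (u1 + 1)) / c"
    using first_order_solution_exists[OF \<open>c > 0\<close>] by blast
  then have "nash_equilibrium c \<alpha> \<mu>0 (minor_response (1 + m + u1 - u2)) u1 u2 m"
    unfolding iff using minor_response_feedback AE_I2 by blast
  then show "\<exists>uc u1 u2 m. nash_equilibrium c \<alpha> \<mu>0 uc u1 u2 m" by blast
  fix uc u1 u2 m uc' u1' u2' m'
  assume "nash_equilibrium c \<alpha> \<mu>0 uc u1 u2 m" and "nash_equilibrium c \<alpha> \<mu>0 uc' u1' u2' m'"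
  then have nonneg: "0 \<le> u1" "0 \<le> u2" "0 \<le> u1'" "0 \<le> u2'"
    and ae: "AE x in \<mu>0. uc x = minor_response (1 + m + u1 - u2) x"
      "AE x in \<mu>0. uc' x = minor_response (1 + m' + u1' - u2') x"
    and m: "m = mean_response \<mu>0 (1 + m + u1 - u2)"
      "m' = mean_response \<mu>0 (1 + m' + u1' - u2')"
    and u: "u1 = (1 - m + 1 / (u2 + 1)) / c" "u2 = (m + 1 / (u1 + 1)) / c"
    and u': "u1' = (1 - m' + 1 / (u2' + 1)) / c" "u2' = (m' + 1 / (u1' + 1)) / c"
    unfolding iff by blast+
  have mean: "m = m'"
    using consistent_mean_le[OF \<open>c > 0\<close> nonneg u u' m]
      consistent_mean_le[OF \<open>c > 0\<close> nonneg(3,4,1,2) u' u m(2,1)] by simp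
  have "m \<le> 1" using mean_response_range(2) m(1) by metis
  then have "u1 \<le> u1'" "u2' \<le> u2" "u1' \<le> u1" "u2 \<le> u2'"
    using major_difference_antimono[OF \<open>c > 0\<close> _ _ nonneg u u']
      major_difference_antimono[OF \<open>c > 0\<close> _ _ nonneg(3,4,1,2) u' u] mean by simp_all
  then have majors: "u1 = u1'" "u2 = u2'" by simp_all
  have "AE x in \<mu>0. uc x = uc' x"
    using ae(1) ae(2)[folded majors mean] by eventually_elim simp
  with majors mean show "(AE x in \<mu>0. uc x = uc' x) \<and> u1 = u1' \<and> u2 = u2' \<and> m = m'" by blast
qed

end
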